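(* Let $\Omega_0\subset\mathbb{R}^2$ be a non-empty open convex set that does not contain lines, let $\Omega_1\subset\mathbb{R}^2$ be an open convex set with $\mathrm{cl}\,\Omega_1\subset\Omega_0$, and let $\Omega=\mathrm{cl}(\Omega_0\setminus\Omega_1)$. Assume that neither $\partial\Omega_0$ nor $\partial\Omega_1$ contains linear segments, that $\Omega_0$ is unbounded, and that every ray contained in $\Omega_0$ can be translated so as to belong to $\Omega_1$ entirely. If $M\in\mathcal{M}_\Omega$, then the non-decreasing rearrangement of the distribution of $M_\infty$ belongs to $\boldsymbol{A}_\Omega$ (on the interval $I=[0,1]$).
   Context: For an interval $I$ and a subinterval $J\subset I$, $\langle\varphi\rangle_J=\frac1{|J|}\int_J\varphi(s)\,ds$, and $$\boldsymbol{A}_\Omega=\{\varphi\in L^1(I,\mathbb{R}^2):\ \varphi(I)\subset\partial\Omega_0,\ \langle\varphi\rangle_J\notin\Omega_1\text{ for every subinterval }J\subset I\}.$$ The fixed boundary $\partial_{\mathrm{fixed}}w$ of a set $w\subset\mathbb{R}^d$ is the set of $x\in\partial w$ that lie in no open segment $\ell\subset\mathrm{cl}\,w$; under the hypotheses above $\partial_{\mathrm{fixed}}\Omega=\partial\Omega_0$. Martingales are discrete-time, over an increasing filtration $\{S_n\}_{n\ge0}$ of finite algebras on the standard probability space $(\mathfrak{S},P)$. For closed $w$, an $\mathbb{R}^d$-valued martingale $M$ adapted to $\{S_n\}$ is a $w$-martingale if: (i) $S_0=\{\emptyset,\mathfrak{S}\}$; (ii) there is a random variable $M_\infty$ with values in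 $\partial_{\mathrm{fixed}}w$, $\mathbb{E}|M_\infty|<\infty$ and $M_n=\mathbb{E}(M_\infty\mid S_n)$; (iii) for every $n\ge0$ and every atom $\sigma$ of $S_n$, $\mathrm{conv}\big(M_n(\sigma),\{M_{n+1}(z)\}_{z\in\sigma}\big)\subset w$. The set of $w$-martingales is $\mathcal{M}_w$. Fix an oriented line $\ell$ such that the orthogonal projection onto $\ell$ is injective on $\partial\Omega_0$. A function $\varphi\colon I\to\partial\Omega_0$ is non-decreasing if its composition with this projection is. The non-decreasing rearrangement of a probability measure $\mu$ on $\partial\Omega_0$ is the (unique up to null sets) non-decreasing function $\varphi\colon[0,1]\to\partial\Omega_0$ such that the image of Lebesgue measure under $\varphi$ is $\mu$.
   Formalization: The formal theorem also requires that M_n converges to M_∞ almost surely; without this the claim fails, e.g. when all S_n are trivial and M_∞ takes two values on the boundary of Ω_0 with mean in Ω whose chord meets Ω_1. *)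

theory Defs
  imports "HOL-Probability.Probability"
begin

definition line :: "'a::real_vector \<Rightarrow> 'a \<Rightarrow> 'a set" where
  "line p v = range (\<lambda>t::real. p + t *\<^sub>R v)"

definition ray :: "'a::real_vector \<Rightarrow> 'a \<Rightarrow> 'a set" where
  "ray p v = (\<lambda>t::real. p + t *\<^sub>R v) ` {0..}"

definition fixed_boundary :: "'a::euclidean_space set \<Rightarrow> 'a set" where
  "fixed_boundary w =
    {x \<in> frontier w. \<not> (\<exists>a b. x \<in> open_segment a b \<and> open_segment a b \<subseteq> closure w)}"

definition average :: "(real \<Rightarrow> 'a::euclidean_space) \<Rightarrow> real set \<Rightarrow> 'a" where
  "average \<phi> J = (1 / measure lebesgue J) *\<^sub>R (LINT s:J|lebesgue. \<phi> s)"

text \<open>Degenerate subintervals, over which averages make no sense, are excluded by requiring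
  positive length.\<close>

definition A_class :: "'a::euclidean_space set \<Rightarrow> 'a set \<Rightarrow> real set \<Rightarrow> (real \<Rightarrow> 'a) set" where
  "A_class \<Omega>\<^sub>0 \<Omega>\<^sub>1 I =
    {\<phi>. \<phi> absolutely_integrable_on I \<and> \<phi> ` I \<subseteq> frontier \<Omega>\<^sub>0 \<and>
        (\<forall>J. is_interval J \<and> J \<subseteq> I \<and> 0 < measure lebesgue J \<longrightarrow> average \<phi> J \<notin> \<Omega>\<^sub>1)}"

text \<open>The standard (atomless) probability space: the unit interval with Lebesgue measure, up to
  an isomorphism modulo null sets. The completion makes the definition insensitive to whether the
  sigma-algebra is already complete (Lebesgue sets) or not (Borel sets).\<close>

definition standard_prob_space :: "'s measure \<Rightarrow> bool" where
  "standard_prob_space P \<longleftrightarrow> prob_space P \<and>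
    (\<exists>N \<in> null_sets (completion P). \<exists>N' \<in> null_sets (lebesgue_on {0..1::real}). \<exists>f.
      let X = restrict_space (completion P) (space P - N);
          Y = lebesgue_on ({0..1} - N')
      in bij_betw f (space X) (space Y) \<and>
         f \<in> measurable X Y \<and> the_inv_into (space X) f \<in> measurable Y X \<and>
         distr X Y f = Y)"

definition finite_filtration :: "'s measure \<Rightarrow> (nat \<Rightarrow> 's set set) \<Rightarrow> bool" where
  "finite_filtration P S \<longleftrightarrow>
    (\<forall>n. algebra (space P) (S n) \<and> finite (S n) \<and> S n \<subseteq> sets P \<and> S n \<subseteq> S (Suc n))"

definition algebra_atoms :: "'s set set \<Rightarrow> 's set set" where
  "algebra_atoms \<A> = {\<sigma> \<in> \<A>. \<sigma> \<noteq> {} \<and> (\<forall>\<tau>\<in>\<A>. \<tau> \<subseteq> \<sigma> \<longrightarrow> \<tau> = {} \<or> \<tau> = \<sigma>)}"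

text \<open>The library has conditional expectations of real functions only, so the vector-valued one is
  taken coordinatewise. A finite algebra is a sigma-algebra, so \<open>sigma (space P) (S n)\<close> has exactly
  the measurable sets \<open>S n\<close>; the measure it carries is irrelevant for \<open>real_cond_exp\<close>.

  An adapted \<open>M n\<close> is constant on each atom \<open>\<sigma>\<close> of \<open>S n\<close>, so \<open>M n ` \<sigma>\<close> is the singleton of the value
  of \<open>M n\<close> on \<open>\<sigma>\<close>.

  \<open>Minf\<close> is the terminal value of the martingale, i.e. the almost sure limit of \<open>M n\<close>. Convergence
  has to be required: it says that \<open>Minf\<close> is measurable with respect to the union of the filtration
  up to null sets. Otherwise, for a constant filtration, \<open>Minf\<close> could be any random variable on the
  fixed boundary whose mean lies in \<open>w\<close>.\<close>

definition w_martingale ::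
  "'s measure \<Rightarrow> (nat \<Rightarrow> 's set set) \<Rightarrow> 'a::euclidean_space set \<Rightarrow> (nat \<Rightarrow> 's \<Rightarrow> 'a) \<Rightarrow> ('s \<Rightarrow> 'a) \<Rightarrow> bool"
where
  "w_martingale P S w M Minf \<longleftrightarrow>
    finite_filtration P S \<and>
    (\<forall>n. M n \<in> borel_measurable (sigma (space P) (S n))) \<and>
    S 0 = {{}, space P} \<and>
    integrable P Minf \<and> (AE x in P. Minf x \<in> fixed_boundary w) \<and>
    (\<forall>n. \<forall>b\<in>Basis. AE x in P.
        M n x \<bullet> b = real_cond_exp P (sigma (space P) (S n)) (\<lambda>y. Minf y \<bullet> b) x) \<and>
    (AE x in P. (\<lambda>n. M n x) \<longlonglongrightarrow> Minf x) \<and>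
    (\<forall>n. \<forall>\<sigma>\<in>algebra_atoms (S n). convex hull (M n ` \<sigma> \<union> M (Suc n) ` \<sigma>) \<subseteq> w)"

text \<open>An oriented line is given by a unit direction \<open>u\<close>: the coordinate on the line of the orthogonal
  projection of \<open>x\<close> is \<open>x \<bullet> u\<close>, up to an additive constant depending on the base point.

  Monotonicity is required on the open interval only: if the distribution is unbounded, no function
  which is finite and monotone on all of \<open>[0,1]\<close> exists. The values at the two end points
  do not matter.\<close>

definition nondecreasing_rearrangement ::
  "'a::euclidean_space \<Rightarrow> 'a set \<Rightarrow> 'a measure \<Rightarrow> (real \<Rightarrow> 'a) \<Rightarrow> bool" where
  "nondecreasing_rearrangement u \<Omega>\<^sub>0 \<mu> \<phi> \<longleftrightarrow>
    \<phi> ` {0..1} \<subseteq> frontier \<Omega>\<^sub>0 \<and>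
    mono_on {0<..<1} (\<lambda>t. \<phi> t \<bullet> u) \<and>
    \<phi> \<in> borel_measurable (lebesgue_on {0..1}) \<and>
    distr (lebesgue_on {0..1}) borel \<phi> = \<mu>"

end

theory Submission
  imports Defs
begin

text \<open>Injectivity of the projection along \<open>u\<close> forces one of the two directions \<open>d\<close> orthogonal to \<open>u\<close> to
  be a recession direction of \<open>\<Omega>\<^sub>0\<close>, hence of \<open>\<Omega>\<^sub>1\<close>; call it upward. For an affine \<open>h\<close> which is negative on
  the part of \<open>\<Omega>\<close> lying on a vertical line \<open>V\<close>, the function \<open>W\<close> equal to \<open>max h 0\<close> to the right of \<open>V\<close>
  and to \<open>0\<close> to the left is convex on each convex subset of \<open>\<Omega>\<close>, so \<open>W (E M\<^sub>\<infinity>) \<le> E (W M\<^sub>\<infinity>)\<close> for every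
  \<open>\<Omega>\<close>-martingale.

  Suppose that the average \<open>m\<close> of \<open>\<phi>\<close> over an interval \<open>J\<close> lies in \<open>\<Omega>\<^sub>1\<close> and, reflecting if necessary, that
  \<open>E M\<^sub>\<infinity>\<close> lies to the right of \<open>m\<close>. Let \<open>B\<close> be the value of \<open>\<phi>\<close> at the right end point of \<open>J\<close>, let \<open>p\<close> be a
  point of \<open>\<Omega>\<^sub>1\<close> slightly below \<open>m\<close>, let \<open>h\<close> vanish on the line through \<open>p\<close> and \<open>B\<close> and be positive above
  it, and let \<open>V\<close> pass through \<open>p\<close>. Then \<open>W \<circ> \<phi> \<le> h \<circ> \<phi>\<close> off \<open>J\<close> and \<open>W \<circ> \<phi> = 0\<close> on \<open>J\<close>, so that
  \<open>h (E M\<^sub>\<infinity>) \<le> W (E M\<^sub>\<infinity>) \<le> h (E M\<^sub>\<infinity>) - |J| h(m)\<close>, which contradicts \<open>h(m) > 0\<close>.\<close>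

section \<open>A Jensen inequality for martingales\<close>

text \<open>The atom is the finite intersection of all members containing \<open>x\<close>. It is
  minimal because a member \<open>\<tau>\<close> inside it that misses \<open>x\<close> makes
  \<open>\<sigma> - \<tau>\<close> a competitor.\<close>

lemma finite_algebra_atom:
  assumes "algebra X \<A>" "finite \<A>" "x \<in> X"
  obtains \<sigma> where "\<sigma> \<in> algebra_atoms \<A>" "x \<in> \<sigma>"
proof
  interpret algebra X \<A> by fact
  define \<sigma> where "\<sigma> = \<Inter> {A \<in> \<A>. x \<in> A}"
  have "X \<in> {A \<in> \<A>. x \<in> A}" using assms(3) by auto
  then have "\<sigma> \<in> \<A>"
    unfolding \<sigma>_def using assms(2) finite_INT[of "{A \<in> \<A>. x \<in> A}" "\<lambda>A. A"] by fastforce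
  show "x \<in> \<sigma>" by (simp add: \<sigma>_def)
  moreover have "\<tau> = {} \<or> \<tau> = \<sigma>" if \<tau>: "\<tau> \<in> \<A>" "\<tau> \<subseteq> \<sigma>" for \<tau>
  proof (cases "x \<in> \<tau>")
    case True
    then show ?thesis using \<tau> by (auto simp: \<sigma>_def)
  next
    case False
    then have "\<sigma> - \<tau> \<in> {A \<in> \<A>. x \<in> A}"
      using \<open>x \<in> \<sigma>\<close> \<open>\<sigma> \<in> \<A>\<close> \<tau> by auto
    then have "\<sigma> \<subseteq> \<sigma> - \<tau>" by (auto simp: \<sigma>_def)
    then show ?thesis using \<tau> by auto
  qed
  ultimately show "\<sigma> \<in> algebra_atoms \<A>"
    using \<open>\<sigma> \<in> \<A>\<close> by (auto simp: algebra_atoms_def)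
qed

section \<open>Positive parts of affine functions, cut off along a hyperplane\<close>

definition wedge :: "'a::euclidean_space \<Rightarrow> real \<Rightarrow> 'a \<Rightarrow> real \<Rightarrow> 'a \<Rightarrow> real" where
  "wedge v \<gamma> a \<beta> x = (if \<gamma> \<le> x \<bullet> v then max (x \<bullet> a + \<beta>) 0 else 0)"

lemma wedge_nonneg: "0 \<le> wedge v \<gamma> a \<beta> x"
  by (simp add: wedge_def)

lemma wedge_le_pos_part: "wedge v \<gamma> a \<beta> x \<le> max (x \<bullet> a + \<beta>) 0"
  by (simp add: wedge_def)

lemma borel_measurable_wedge [measurable]: "wedge v \<gamma> a \<beta> \<in> borel_measurable borel"
  unfolding wedge_def by measurable

text \<open>Convexity of \<open>wedge\<close> on \<open>C\<close> in subgradient form: the affine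
  function touches it at \<open>x\<close>. If it exceeded \<open>wedge\<close> at \<open>y\<close>,
  then \<open>y\<close> would lie left of the cut with a positive value, and the segment to
  \<open>x\<close> would cross the cut in \<open>w\<close> with a nonnegative value, against
  \<open>below\<close>.\<close>

lemma affine_le_wedge:
  assumes below: "\<And>x. x \<in> w \<Longrightarrow> x \<bullet> v = \<gamma> \<Longrightarrow> x \<bullet> a + \<beta> < 0"
    and C: "convex C" "C \<subseteq> w" "x \<in> C" "y \<in> C"
    and x: "\<gamma> \<le> x \<bullet> v" "0 \<le> x \<bullet> a + \<beta>"
  shows "y \<bullet> a + \<beta> \<le> wedge v \<gamma> a \<beta> y"
proof (cases "\<gamma> \<le> y \<bullet> v \<or> y \<bullet> a + \<beta> \<le> 0")
  case True
  then show ?thesis by (auto simp: wedge_def)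
next
  case False
  define t where "t = (\<gamma> - y \<bullet> v) / (x \<bullet> v - y \<bullet> v)"
  have t: "0 \<le> t" "t \<le> 1" "t * (x \<bullet> v - y \<bullet> v) = \<gamma> - y \<bullet> v"
    using False x by (auto simp: t_def field_simps)
  define z where "z = (1 - t) *\<^sub>R y + t *\<^sub>R x"
  have "z \<in> C"
    unfolding z_def using C t convexD_alt by blast
  moreover have "z \<bullet> v = \<gamma>"
    using t(3) by (simp add: z_def inner_simps algebra_simps)
  moreover have "0 \<le> (1 - t) * (y \<bullet> a + \<beta>) + t * (x \<bullet> a + \<beta>)"
    using False x(2) t(1,2) by (intro add_nonneg_nonneg[OF mult_nonneg_nonneg mult_nonneg_nonneg]) linarith+
  then have "0 \<le> z \<bullet> a + \<beta>"
    by (simp add: z_def inner_simps algebra_simps)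
  ultimately show ?thesis using below C by fastforce
qed

text \<open>\<open>wedge\<close> jumps only at points of the cut where the affine function is
  positive; near a point of the cut where it is negative, \<open>wedge\<close> vanishes.\<close>

lemma tendsto_wedge:
  assumes "X \<longlonglongrightarrow> x" and "x \<bullet> v = \<gamma> \<Longrightarrow> x \<bullet> a + \<beta> < 0"
  shows "(\<lambda>n. wedge v \<gamma> a \<beta> (X n)) \<longlonglongrightarrow> wedge v \<gamma> a \<beta> x"
proof -
  have v: "(\<lambda>n. X n \<bullet> v) \<longlonglongrightarrow> x \<bullet> v"
    and a: "(\<lambda>n. X n \<bullet> a + \<beta>) \<longlonglongrightarrow> x \<bullet> a + \<beta>"
    using assms(1) by (auto intro!: tendsto_intros)
  consider "x \<bullet> v < \<gamma>" | "\<gamma> < x \<bullet> v" | "x \<bullet> v = \<gamma>" by linarith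
  then show ?thesis
  proof cases
    case 1
    have "eventually (\<lambda>n. wedge v \<gamma> a \<beta> (X n) = wedge v \<gamma> a \<beta> x) sequentially"
      using order_tendstoD(2)[OF v 1] by eventually_elim (use 1 in \<open>auto simp: wedge_def\<close>)
    then show ?thesis by (rule tendsto_eventually)
  next
    case 2
    have "(\<lambda>n. max (X n \<bullet> a + \<beta>) 0) \<longlonglongrightarrow> wedge v \<gamma> a \<beta> x"
      using tendsto_max[OF a tendsto_const] 2 by (simp add: wedge_def)
    moreover have "eventually (\<lambda>n. max (X n \<bullet> a + \<beta>) 0 = wedge v \<gamma> a \<beta> (X n)) sequentially"
      using order_tendstoD(1)[OF v 2] by eventually_elim (auto simp: wedge_def)
    ultimately show ?thesis by (rule Lim_transform_eventually)
  next
    case 3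
    have "eventually (\<lambda>n. wedge v \<gamma> a \<beta> (X n) = wedge v \<gamma> a \<beta> x) sequentially"
      using order_tendstoD(2)[OF a assms(2)[OF 3]]
      by eventually_elim (use assms(2)[OF 3] in \<open>auto simp: wedge_def\<close>)
    then show ?thesis by (rule tendsto_eventually)
  qed
qed

context finite_measure
begin

lemma integrable_pos_part:
  fixes f :: "'a \<Rightarrow> 'b::euclidean_space"
  shows "integrable M f \<Longrightarrow> integrable M (\<lambda>x. max (f x \<bullet> a + \<beta>) 0)"
  by (intro integrable_max) auto

lemma integrable_wedge:
  fixes f :: "'a \<Rightarrow> 'b::euclidean_space"
  assumes "integrable M f" shows "integrable M (\<lambda>x. wedge v \<gamma> a \<beta> (f x))"
proof (rule Bochner_Integration.integrable_bound[OF integrable_pos_part[OF assms, of a \<beta>]])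
  show "(\<lambda>x. wedge v \<gamma> a \<beta> (f x)) \<in> borel_measurable M"
    using assms by (intro measurable_compose[OF _ borel_measurable_wedge]) auto
qed (auto simp: wedge_def)

end

section \<open>Martingales confined to a closed set\<close>

locale w_martingale_on = prob_space P for P :: "'s measure" +
  fixes S :: "nat \<Rightarrow> 's set set" and w :: "'a::euclidean_space set"
    and M :: "nat \<Rightarrow> 's \<Rightarrow> 'a" and Minf :: "'s \<Rightarrow> 'a"
  assumes w_martingale: "w_martingale P S w M Minf" and closed: "closed w"
begin

lemma algebra_S: "algebra (space P) (S n)" and finite_S: "finite (S n)"
  and S_sub: "S n \<subseteq> sets P" and S_Suc: "S n \<subseteq> S (Suc n)" and S_0: "S 0 = {{}, space P}"
  and integrable_Minf: "integrable P Minf"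
  and measurable_M: "M n \<in> borel_measurable (sigma (space P) (S n))"
  and converges: "AE x in P. (\<lambda>n. M n x) \<longlonglongrightarrow> Minf x"
  and hull_subset: "\<sigma> \<in> algebra_atoms (S n) \<Longrightarrow> convex hull (M n ` \<sigma> \<union> M (Suc n) ` \<sigma>) \<subseteq> w"
  and cond_exp: "b \<in> Basis \<Longrightarrow>
      AE x in P. M n x \<bullet> b = real_cond_exp P (sigma (space P) (S n)) (\<lambda>y. Minf y \<bullet> b) x"
  using w_martingale unfolding w_martingale_def finite_filtration_def by blast+

lemma space_F [simp]: "space (sigma (space P) (S n)) = space P"
  and sets_F: "sets (sigma (space P) (S n)) = S n"
proof -
  interpret algebra "space P" "S n" by (rule algebra_S)
  have "sigma_algebra (space P) (S n)"
    using finite_S by (rule algebra.is_sigma_algebra[OF algebra_S])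
  then show "sets (sigma (space P) (S n)) = S n"
    using space_closed by (metis sets_measure_of sigma_algebra.sigma_sets_eq)
qed (simp add: space_measure_of_conv)

lemma subalgebra_F: "subalgebra P (sigma (space P) (S n))"
  using S_sub by (simp add: subalgebra_def sets_F)

lemma borel_M [measurable]: "M n \<in> borel_measurable P"
  using measurable_from_subalg[OF subalgebra_F measurable_M] .

lemma borel_Minf [measurable]: "Minf \<in> borel_measurable P"
  using integrable_Minf by auto

lemma in_S: "{y. Q y} \<in> sets borel \<Longrightarrow> {x \<in> space P. Q (M n x)} \<in> S n"
  using measurable_sets[OF measurable_M, of "{y. Q y}" n]
  by (simp add: sets_F vimage_def Int_def conj_commute)

lemma integrable_M_Basis:
  assumes "b \<in> Basis" shows "integrable P (\<lambda>x. M n x \<bullet> b)"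
    and "A \<in> S n \<Longrightarrow> (LINT x:A|P. M n x \<bullet> b) = (LINT x:A|P. Minf x \<bullet> b)"
proof -
  interpret F: finite_measure_subalgebra P "sigma (space P) (S n)"
    using subalgebra_F by unfold_locales
  have i: "integrable P (\<lambda>x. Minf x \<bullet> b)"
    using integrable_Minf by auto
  show "integrable P (\<lambda>x. M n x \<bullet> b)"
    using F.real_cond_exp_int(1)[OF i] cond_exp[OF assms, of n]
    by (subst integrable_cong_AE) auto
  assume A: "A \<in> S n"
  then have [measurable]: "A \<in> sets P" using S_sub by auto
  have "(LINT x:A|P. M n x \<bullet> b) =
        (LINT x:A|P. real_cond_exp P (sigma (space P) (S n)) (\<lambda>y. Minf y \<bullet> b) x)"
    using cond_exp[OF assms, of n] by (intro set_lebesgue_integral_cong_AE) auto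
  also have "\<dots> = (LINT x:A|P. Minf x \<bullet> b)"
    using F.real_cond_exp_intA[OF i] A by (simp add: sets_F)
  finally show "(LINT x:A|P. M n x \<bullet> b) = (LINT x:A|P. Minf x \<bullet> b)" .
qed

lemma integrable_M: "integrable P (M n)"
proof -
  have "integrable P (\<lambda>x. \<Sum>b\<in>Basis. (M n x \<bullet> b) *\<^sub>R b)"
    using integrable_M_Basis(1) by auto
  then show ?thesis by (simp add: euclidean_representation)
qed

text \<open>The conditional expectations are given coordinatewise, so the functional is expanded
  over \<open>Basis\<close> before integrals are compared.\<close>

lemma integral_affine_M:
  assumes A: "A \<in> S n"
  shows "(LINT x:A|P. M n x \<bullet> a + \<beta>) = (LINT x:A|P. Minf x \<bullet> a + \<beta>)"
proof -
  have [measurable]: "A \<in> sets P" using A S_sub by auto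
  have set_int: "set_integrable P A (\<lambda>x. X x \<bullet> a)" if "integrable P X" for X
    unfolding set_integrable_def using that by (intro integrable_mult_indicator) auto
  have int_b: "set_integrable P A (\<lambda>x. (a \<bullet> b) * (X x \<bullet> b))" if "integrable P X" for X b
    unfolding set_integrable_def using that by (intro integrable_mult_indicator) auto
  have sum: "(LINT x:A|P. X x \<bullet> a) = (\<Sum>b\<in>Basis. (a \<bullet> b) * (LINT x:A|P. X x \<bullet> b))"
    if X: "integrable P X" for X
  proof -
    have "(LINT x:A|P. X x \<bullet> a) = (LINT x:A|P. (\<Sum>b\<in>Basis. (a \<bullet> b) * (X x \<bullet> b)))"
      by (subst euclidean_inner) (simp add: mult.commute)
    also have "\<dots> = (\<Sum>b\<in>Basis. (LINT x:A|P. (a \<bullet> b) * (X x \<bullet> b)))"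
      using int_b[OF X] unfolding set_lebesgue_integral_def set_integrable_def scaleR_sum_right
      by (intro Bochner_Integration.integral_sum) auto
    finally show ?thesis by simp
  qed
  have "(LINT x:A|P. M n x \<bullet> a) = (LINT x:A|P. Minf x \<bullet> a)"
    unfolding sum[OF integrable_M] sum[OF integrable_Minf]
    by (intro sum.cong refl) (simp only: integrable_M_Basis(2)[OF _ A])
  moreover have b: "set_integrable P A (\<lambda>x. \<beta>)"
    unfolding set_integrable_def by (intro integrable_mult_indicator) auto
  ultimately show ?thesis
    unfolding set_integral_add(2)[OF set_int[OF integrable_M] b]
      set_integral_add(2)[OF set_int[OF integrable_Minf] b] by simp
qed

text \<open>The hull belonging to the atom of \<open>x\<close> serves as \<open>C\<close> for both
  consecutive values. Later arguments use this pointwise form instead of atoms.\<close>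

lemma M_in: "x \<in> space P \<Longrightarrow> M n x \<in> w"
  and step_convex: "x \<in> space P \<Longrightarrow> \<exists>C. convex C \<and> C \<subseteq> w \<and> M n x \<in> C \<and> M (Suc n) x \<in> C"
proof -
  assume "x \<in> space P"
  then obtain \<sigma> where \<sigma>: "\<sigma> \<in> algebra_atoms (S n)" "x \<in> \<sigma>"
    using finite_algebra_atom[OF algebra_S finite_S] by blast
  define C where "C = convex hull (M n ` \<sigma> \<union> M (Suc n) ` \<sigma>)"
  have "M n x \<in> C" "M (Suc n) x \<in> C"
    unfolding C_def using \<sigma>(2) by (intro hull_inc; simp)+
  moreover have "convex C" "C \<subseteq> w"
    unfolding C_def by (rule convex_convex_hull) (rule hull_subset[OF \<sigma>(1)])
  ultimately show "M n x \<in> w" "\<exists>C. convex C \<and> C \<subseteq> w \<and> M n x \<in> C \<and> M (Suc n) x \<in> C"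
    by (meson subsetD)+
qed

lemma AE_Minf_in: "AE x in P. Minf x \<in> w"
  using converges AE_space[of P]
proof eventually_elim
  case (elim x)
  show ?case
    by (rule closed_sequentially[OF closed _ elim(1)]) (rule M_in[OF elim(2)])
qed

lemma M_0_eq: "x \<in> space P \<Longrightarrow> M 0 x = expectation Minf"
proof -
  assume x: "x \<in> space P"
  have const: "M 0 y = M 0 x" if "y \<in> space P" for y
  proof -
    \<comment> \<open>A nonempty level set in the trivial algebra is the whole space.\<close>
    have "{y \<in> space P. M 0 y = M 0 x} \<in> S 0"
      by (rule in_S) auto
    then show ?thesis using x that S_0 by auto
  qed
  show ?thesis
  proof (rule euclidean_eqI)
    fix b :: 'a assume b: "b \<in> Basis"
    have "M 0 x \<bullet> b = expectation (\<lambda>y. M 0 x \<bullet> b)"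
      by (simp add: prob_space)
    also have "\<dots> = expectation (\<lambda>y. M 0 y \<bullet> b)"
      by (intro Bochner_Integration.integral_cong) (auto simp: const)
    also have "\<dots> = (LINT y:space P|P. M 0 y \<bullet> b)"
      using integrable_M_Basis(1)[OF b] by (simp add: set_integral_space)
    also have "\<dots> = (LINT y:space P|P. Minf y \<bullet> b)"
      using integrable_M_Basis(2)[OF b] S_0 by simp
    also have "\<dots> = expectation Minf \<bullet> b"
      using integrable_Minf by (simp add: set_integral_space)
    finally show "M 0 x \<bullet> b = expectation Minf \<bullet> b" .
  qed
qed

lemma expectation_Minf_in: "expectation Minf \<in> w"
  using M_0_eq M_in not_empty by (metis ex_in_conv)

text \<open>Over \<open>D\<close>, a set of \<open>S n\<close>, the positive part is affine, so its
  integral equals that of the affine function of \<open>Minf\<close>, which the positive part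
  dominates. This bound feeds Fatou's lemma below.\<close>

lemma expectation_pos_part_le:
  "expectation (\<lambda>x. max (M n x \<bullet> a + \<beta>) 0) \<le> expectation (\<lambda>x. max (Minf x \<bullet> a + \<beta>) 0)"
proof -
  define D where "D = {x \<in> space P. 0 \<le> M n x \<bullet> a + \<beta>}"
  have D: "D \<in> S n" unfolding D_def by (rule in_S) auto
  then have [measurable]: "D \<in> sets P" using S_sub by auto
  have "expectation (\<lambda>x. max (M n x \<bullet> a + \<beta>) 0) = (LINT x:D|P. M n x \<bullet> a + \<beta>)"
    unfolding set_lebesgue_integral_def
    by (intro Bochner_Integration.integral_cong) (auto simp: D_def indicator_def)
  also have "\<dots> = (LINT x:D|P. Minf x \<bullet> a + \<beta>)"
    by (rule integral_affine_M[OF D])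
  also have "\<dots> \<le> expectation (\<lambda>x. max (Minf x \<bullet> a + \<beta>) 0)"
    unfolding set_lebesgue_integral_def
  proof (rule integral_mono)
    show "integrable P (\<lambda>x. indicat_real D x *\<^sub>R (Minf x \<bullet> a + \<beta>))"
      using integrable_Minf by (intro integrable_mult_indicator) auto
    show "integrable P (\<lambda>x. max (Minf x \<bullet> a + \<beta>) 0)"
      by (rule integrable_pos_part[OF integrable_Minf])
  qed (auto simp: indicator_def)
  finally show ?thesis .
qed

text \<open>The wedge of \<open>M n\<close> is affine on \<open>D\<close> and zero off
  \<open>D\<close>. Replacing \<open>M n\<close> by \<open>M (Suc n)\<close> over \<open>D\<close>
  keeps the integral, and \<open>affine_le_wedge\<close> bounds the new integrand pointwise.\<close>

lemma wedge_submartingale: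
  assumes below: "\<And>x. x \<in> w \<Longrightarrow> x \<bullet> v = \<gamma> \<Longrightarrow> x \<bullet> a + \<beta> < 0"
  shows "expectation (\<lambda>x. wedge v \<gamma> a \<beta> (M n x)) \<le> expectation (\<lambda>x. wedge v \<gamma> a \<beta> (M (Suc n) x))"
proof -
  define D where "D = {x \<in> space P. \<gamma> \<le> M n x \<bullet> v \<and> 0 \<le> M n x \<bullet> a + \<beta>}"
  have D: "D \<in> S n" unfolding D_def by (rule in_S) auto
  then have [measurable]: "D \<in> sets P" using S_sub by auto
  have "expectation (\<lambda>x. wedge v \<gamma> a \<beta> (M n x)) = (LINT x:D|P. M n x \<bullet> a + \<beta>)"
    unfolding set_lebesgue_integral_def
    by (intro Bochner_Integration.integral_cong) (auto simp: D_def indicator_def wedge_def)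
  \<comment> \<open>\<open>D\<close> also belongs to \<open>S (Suc n)\<close>, so both sides equal
    the integral for \<open>Minf\<close> over \<open>D\<close>.\<close>
  also have "\<dots> = (LINT x:D|P. M (Suc n) x \<bullet> a + \<beta>)"
    using integral_affine_M[OF D] integral_affine_M[OF subsetD[OF S_Suc D]] by simp
  also have "\<dots> \<le> expectation (\<lambda>x. wedge v \<gamma> a \<beta> (M (Suc n) x))"
    unfolding set_lebesgue_integral_def
  proof (rule integral_mono)
    show "integrable P (\<lambda>x. indicat_real D x *\<^sub>R (M (Suc n) x \<bullet> a + \<beta>))"
      using integrable_M by (intro integrable_mult_indicator) auto
    show "integrable P (\<lambda>x. wedge v \<gamma> a \<beta> (M (Suc n) x))"
      by (rule integrable_wedge[OF integrable_M])
    fix x assume "x \<in> space P"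
    then obtain C where "convex C" "C \<subseteq> w" "M n x \<in> C" "M (Suc n) x \<in> C"
      using step_convex by blast
    then show "indicat_real D x *\<^sub>R (M (Suc n) x \<bullet> a + \<beta>) \<le> wedge v \<gamma> a \<beta> (M (Suc n) x)"
      using affine_le_wedge[OF below] wedge_nonneg by (auto simp: D_def indicator_def)
  qed
  finally show ?thesis .
qed

text \<open>Fatou's lemma is applied to the nonnegative difference between the positive part of the affine
  function and the wedge: no uniform integrability is needed.\<close>

lemma wedge_expectation_le:
  assumes below: "\<And>x. x \<in> w \<Longrightarrow> x \<bullet> v = \<gamma> \<Longrightarrow> x \<bullet> a + \<beta> < 0"
  shows "wedge v \<gamma> a \<beta> (expectation Minf) \<le> expectation (\<lambda>x. wedge v \<gamma> a \<beta> (Minf x))"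
proof -
  let ?W = "wedge v \<gamma> a \<beta>" and ?h = "\<lambda>x. max (x \<bullet> a + \<beta>) 0"
  define c where "c = expectation (\<lambda>x. ?h (Minf x)) - ?W (expectation Minf)"
  have "expectation (\<lambda>x. ?W (M 0 x)) = expectation (\<lambda>x. ?W (expectation Minf))"
    by (intro Bochner_Integration.integral_cong) (auto simp: M_0_eq)
  then have "expectation (\<lambda>x. ?W (M 0 x)) = ?W (expectation Minf)"
    by (simp add: prob_space)
  moreover have "incseq (\<lambda>n. expectation (\<lambda>x. ?W (M n x)))"
    using wedge_submartingale[OF below] by (intro incseq_SucI)
  ultimately have W: "?W (expectation Minf) \<le> expectation (\<lambda>x. ?W (M n x))" for n
    by (metis incseqD le0)
  have nn: "(\<integral>\<^sup>+x. ennreal (?h (X x) - ?W (X x)) \<partial>P) =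
            ennreal (expectation (\<lambda>x. ?h (X x)) - expectation (\<lambda>x. ?W (X x)))"
    if "integrable P X" for X
    using integrable_pos_part[OF that, of a \<beta>] integrable_wedge[OF that, of v \<gamma> a \<beta>]
    by (subst nn_integral_eq_integral) (auto simp: wedge_le_pos_part)
  \<comment> \<open>The bound is uniform in \<open>n\<close>: the expected positive part stays below
    its terminal value, the expected wedge above its initial one.\<close>
  have M_le: "(\<integral>\<^sup>+x. ennreal (?h (M n x) - ?W (M n x)) \<partial>P) \<le> ennreal c" for n
    unfolding nn[OF integrable_M] c_def
    using W[of n] expectation_pos_part_le[of n a \<beta>] by (intro ennreal_leI) simp
  have lim: "AE x in P. liminf (\<lambda>n. ennreal (?h (M n x) - ?W (M n x))) = ennreal (?h (Minf x) - ?W (Minf x))"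
    using converges AE_Minf_in
  proof eventually_elim
    case (elim x)
    \<comment> \<open>\<open>Minf x\<close> lies in \<open>w\<close>, so \<open>below\<close> rules
      out a jump of the wedge at the limit.\<close>
    have "(\<lambda>n. ?h (M n x) - ?W (M n x)) \<longlonglongrightarrow> ?h (Minf x) - ?W (Minf x)"
      using elim below by (intro tendsto_diff tendsto_wedge tendsto_max tendsto_intros) auto
    then show ?case
      by (intro lim_imp_Liminf tendsto_ennrealI) auto
  qed
  have "(\<integral>\<^sup>+x. ennreal (?h (Minf x) - ?W (Minf x)) \<partial>P) =
        (\<integral>\<^sup>+x. liminf (\<lambda>n. ennreal (?h (M n x) - ?W (M n x))) \<partial>P)"
    using lim by (intro nn_integral_cong_AE) auto
  also have "\<dots> \<le> liminf (\<lambda>n. \<integral>\<^sup>+x. ennreal (?h (M n x) - ?W (M n x)) \<partial>P)"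
    by (intro nn_integral_liminf) measurable
  also have "\<dots> \<le> liminf (\<lambda>n. ennreal c)"
    using M_le by (intro Liminf_mono) auto
  finally have "ennreal (expectation (\<lambda>x. ?h (Minf x)) - expectation (\<lambda>x. ?W (Minf x))) \<le> ennreal c"
    by (simp add: nn[OF integrable_Minf] Liminf_const)
  \<comment> \<open>\<open>ennreal\<close> sends negative reals to 0, so \<open>0 \<le> c\<close> is
    established before returning to the reals.\<close>
  moreover have "expectation (\<lambda>x. ?W (M 0 x)) \<le> expectation (\<lambda>x. ?h (M 0 x))"
    by (intro integral_mono integrable_wedge integrable_pos_part integrable_M wedge_le_pos_part)
  then have "0 \<le> c"
    using W[of 0] expectation_pos_part_le[of 0 a \<beta>] \<open>_ \<le> expectation (\<lambda>x. ?h (M 0 x))\<close>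
    by (simp add: c_def)
  ultimately show ?thesis by (simp add: c_def ennreal_le_iff)
qed

end

section \<open>Domains above a graph\<close>

text \<open>\<open>v\<close> gives the horizontal coordinate and \<open>d\<close> points upward. By
  \<open>plane\<close> the fibres of \<open>x \<bullet> v\<close> are lines in direction
  \<open>d\<close>, so by injectivity the frontier is a graph. Keeping \<open>v\<close> abstract
  covers both \<open>u\<close> and its reflection.\<close>

locale graph_domain =
  fixes \<Omega>\<^sub>0 :: "'a::euclidean_space set" and v d :: 'a
  assumes open_dom: "open \<Omega>\<^sub>0" and convex_dom: "convex \<Omega>\<^sub>0"
    and inj_frontier: "inj_on (\<lambda>x. x \<bullet> v) (frontier \<Omega>\<^sub>0)"
    and orth: "d \<bullet> v = 0" and unit: "d \<bullet> d = 1"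
    and plane: "x \<bullet> v = 0 \<Longrightarrow> x = (x \<bullet> d) *\<^sub>R d"
    and upward: "x \<in> \<Omega>\<^sub>0 \<Longrightarrow> 0 \<le> t \<Longrightarrow> x + t *\<^sub>R d \<in> \<Omega>\<^sub>0"
begin

lemma same_fibre: "x \<bullet> v = y \<bullet> v \<Longrightarrow> x = y + ((x - y) \<bullet> d) *\<^sub>R d"
  using plane[of "x - y"] by (simp add: inner_diff_left algebra_simps)

lemma frontier_disjoint: "x \<in> \<Omega>\<^sub>0 \<Longrightarrow> x \<notin> frontier \<Omega>\<^sub>0"
  using open_dom by (simp add: frontier_def interior_open)

lemma upward_closure:
  assumes "x \<in> closure \<Omega>\<^sub>0" "0 \<le> t" shows "x + t *\<^sub>R d \<in> closure \<Omega>\<^sub>0"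
proof -
  have "t *\<^sub>R d + x \<in> (+) (t *\<^sub>R d) ` closure \<Omega>\<^sub>0" using assms(1) by auto
  also have "\<dots> = closure ((+) (t *\<^sub>R d) ` \<Omega>\<^sub>0)" by (simp add: closure_translation)
  also have "\<dots> \<subseteq> closure \<Omega>\<^sub>0"
    using upward assms(2) by (intro closure_mono) (auto simp: add.commute)
  finally show ?thesis by (simp add: add.commute)
qed

text \<open>Otherwise moving up from \<open>q\<close> would reach \<open>x\<close> inside the open
  domain.\<close>

lemma frontier_below:
  assumes "x \<in> frontier \<Omega>\<^sub>0" "q \<in> \<Omega>\<^sub>0" "x \<bullet> v = q \<bullet> v"
  shows "x \<bullet> d < q \<bullet> d"
proof (rule ccontr)
  assume "\<not> ?thesis"
  then have "q + ((x - q) \<bullet> d) *\<^sub>R d \<in> \<Omega>\<^sub>0"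
    using assms(2) by (intro upward) (auto simp: inner_diff_left)
  then show False
    using same_fibre[OF assms(3)] frontier_disjoint assms(1) by auto
qed

lemma frontier_below_closure:
  assumes "x \<in> frontier \<Omega>\<^sub>0" "q \<in> closure \<Omega>\<^sub>0" "x \<bullet> v = q \<bullet> v"
  shows "x \<bullet> d \<le> q \<bullet> d"
proof (cases "q \<in> \<Omega>\<^sub>0")
  case True
  then show ?thesis using frontier_below[OF assms(1) _ assms(3)] by simp
next
  case False
  then have "q \<in> frontier \<Omega>\<^sub>0"
    using assms(2) open_dom by (simp add: frontier_def interior_open)
  then show ?thesis using inj_onD[OF inj_frontier assms(3) assms(1)] by simp
qed

text \<open>The chord point \<open>q\<close> on the vertical line through \<open>x\<close> is in the
  closure by convexity, so \<open>x\<close> is not above it. The affine function is nonpositive at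
  \<open>q\<close> and does not grow on the way down to \<open>x\<close>.\<close>

lemma frontier_below_chord:
  assumes x: "x \<in> frontier \<Omega>\<^sub>0" and q: "q\<^sub>1 \<in> closure \<Omega>\<^sub>0" "q\<^sub>2 \<in> closure \<Omega>\<^sub>0"
    and between: "q\<^sub>1 \<bullet> v \<le> x \<bullet> v" "x \<bullet> v \<le> q\<^sub>2 \<bullet> v"
    and a: "0 \<le> d \<bullet> a" "q\<^sub>1 \<bullet> a + \<beta> \<le> 0" "q\<^sub>2 \<bullet> a + \<beta> \<le> 0"
  shows "x \<bullet> a + \<beta> \<le> 0"
proof -
  obtain t where t: "0 \<le> t" "t \<le> 1" "x \<bullet> v = (1 - t) * (q\<^sub>1 \<bullet> v) + t * (q\<^sub>2 \<bullet> v)"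
  proof (cases "q\<^sub>1 \<bullet> v = q\<^sub>2 \<bullet> v")
    case True
    then show ?thesis using between by (intro that[of 0]) auto
  next
    case False
    let ?t = "(x \<bullet> v - q\<^sub>1 \<bullet> v) / (q\<^sub>2 \<bullet> v - q\<^sub>1 \<bullet> v)"
    have "?t * (q\<^sub>2 \<bullet> v - q\<^sub>1 \<bullet> v) = x \<bullet> v - q\<^sub>1 \<bullet> v" using False by simp
    then have "x \<bullet> v = (1 - ?t) * (q\<^sub>1 \<bullet> v) + ?t * (q\<^sub>2 \<bullet> v)" by argo
    then show ?thesis using between False by (intro that[of ?t]) (auto simp: divide_simps)
  qed
  define q where "q = (1 - t) *\<^sub>R q\<^sub>1 + t *\<^sub>R q\<^sub>2"
  have "q \<in> closure \<Omega>\<^sub>0"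
    unfolding q_def using q t convexD_alt[OF convex_closure[OF convex_dom]] by blast
  moreover have qv: "x \<bullet> v = q \<bullet> v"
    using t(3) by (simp add: q_def inner_simps)
  ultimately have "(x - q) \<bullet> d \<le> 0"
    using frontier_below_closure[OF x] by (simp add: inner_diff_left)
  then have "((x - q) \<bullet> d) * (d \<bullet> a) \<le> 0"
    using a(1) by (intro mult_nonpos_nonneg)
  moreover have "x \<bullet> a = q \<bullet> a + ((x - q) \<bullet> d) * (d \<bullet> a)"
    by (subst same_fibre[OF qv]) (simp add: inner_add_left)
  moreover have "(1 - t) * (q\<^sub>1 \<bullet> a + \<beta>) + t * (q\<^sub>2 \<bullet> a + \<beta>) \<le> 0"
    using a t(1,2) by (intro add_nonpos_nonpos[OF mult_nonneg_nonpos mult_nonneg_nonpos]) linarith+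
  then have "q \<bullet> a + \<beta> \<le> 0"
    by (simp add: q_def inner_simps algebra_simps)
  ultimately show ?thesis by linarith
qed

text \<open>If \<open>x\<close> were below the line, lifting it vertically onto the line would give
  a point \<open>q\<close> of the closure beyond \<open>B\<close>. Then \<open>B\<close> would lie
  strictly between \<open>q\<close> and the interior point \<open>p\<close>, hence in the
  interior.\<close>

lemma frontier_above_line:
  assumes p: "p \<in> \<Omega>\<^sub>0" and B: "B \<in> frontier \<Omega>\<^sub>0" "p \<bullet> v < B \<bullet> v"
    and a: "d \<bullet> a = 1" "p \<bullet> a + \<beta> = 0" "B \<bullet> a + \<beta> = 0"
    and x: "x \<in> frontier \<Omega>\<^sub>0" "B \<bullet> v \<le> x \<bullet> v"
  shows "0 \<le> x \<bullet> a + \<beta>"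
proof (rule ccontr)
  assume neg: "\<not> ?thesis"
  define q where "q = x + (- (x \<bullet> a + \<beta>)) *\<^sub>R d"
  have q: "q \<in> closure \<Omega>\<^sub>0" "q \<bullet> a + \<beta> = 0" "q \<bullet> v = x \<bullet> v"
    using x(1) neg a(1) orth unfolding q_def
    by (auto intro!: upward_closure simp: frontier_def inner_simps)
  define t where "t = (B \<bullet> v - p \<bullet> v) / (q \<bullet> v - p \<bullet> v)"
  have "B \<noteq> x" using neg a(3) by auto
  then have "B \<bullet> v < x \<bullet> v"
    using x inj_onD[OF inj_frontier _ B(1) x(1)] by fastforce
  then have t: "0 < t" "t < 1" "t * (q \<bullet> v - p \<bullet> v) = B \<bullet> v - p \<bullet> v"
    using B(2) q(3) by (auto simp: t_def divide_simps)
  define z where "z = q - (1 - t) *\<^sub>R (q - p)"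
  have "z \<in> interior \<Omega>\<^sub>0"
    unfolding z_def
    using mem_interior_closure_convex_shrink[OF convex_dom, of p q "1 - t"] p q t open_dom
    by (simp add: interior_open)
  \<comment> \<open>Both points lie on one vertical line and are zeros of the affine function, whose
    slope along \<open>d\<close> is 1.\<close>
  moreover have "z = B"
  proof -
    have "z \<bullet> v = B \<bullet> v"
      using t(3) by (simp add: z_def inner_simps algebra_simps)
    then have zB: "z = B + ((z - B) \<bullet> d) *\<^sub>R d" by (rule same_fibre)
    have "z \<bullet> a + \<beta> = t * (q \<bullet> a + \<beta>) + (1 - t) * (p \<bullet> a + \<beta>)"
      by (simp add: z_def inner_simps algebra_simps)
    then have "z \<bullet> a = B \<bullet> a" using q a by simp
    moreover have "z \<bullet> a = B \<bullet> a + (z - B) \<bullet> d"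
      using a(1) by (subst zB) (simp add: inner_add_left)
    ultimately show ?thesis using zB by simp
  qed
  ultimately show False using B(1) by (simp add: frontier_def)
qed

end

section \<open>Averages of frontier-valued functions\<close>

text \<open>\<open>G\<close> is a set of full measure, later the open unit interval, so that end
  points can be ignored.\<close>

locale frontier_average = graph_domain \<Omega>\<^sub>0 v d + prob_space Q
  for \<Omega>\<^sub>0 :: "'a::euclidean_space set" and v d and Q :: "'t measure" +
  fixes f :: "'t \<Rightarrow> 'a" and J G :: "'t set" and mean :: 'a
  assumes integrable_f: "integrable Q f" and J: "J \<in> sets Q" "0 < prob J"
    and AE_G: "AE t in Q. t \<in> G" and f_frontier: "t \<in> G \<Longrightarrow> f t \<in> frontier \<Omega>\<^sub>0"
  defines "mean \<equiv> (1 / prob J) *\<^sub>R (LINT t:J|Q. f t)"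
begin

lemma integrable_affine:
  "integrable Q (\<lambda>t. f t \<bullet> a + \<beta>)" "integrable Q (\<lambda>t. indicat_real J t * (f t \<bullet> a + \<beta>))"
  "expectation (\<lambda>t. f t \<bullet> a + \<beta>) = expectation f \<bullet> a + \<beta>"
proof -
  show *: "integrable Q (\<lambda>t. f t \<bullet> a + \<beta>)" using integrable_f by auto
  show "integrable Q (\<lambda>t. indicat_real J t * (f t \<bullet> a + \<beta>))"
    using integrable_mult_indicator[OF J(1) *] by simp
  show "expectation (\<lambda>t. f t \<bullet> a + \<beta>) = expectation f \<bullet> a + \<beta>"
    using integrable_f by (simp add: prob_space)
qed

lemma expectation_on_J:
  "expectation (\<lambda>t. indicat_real J t * (f t \<bullet> a + \<beta>)) = prob J * (mean \<bullet> a + \<beta>)"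
proof -
  have i: "integrable Q (\<lambda>t. indicat_real J t *\<^sub>R f t)"
    by (rule integrable_mult_indicator[OF J(1) integrable_f])
  have "expectation (\<lambda>t. indicat_real J t * (f t \<bullet> a + \<beta>)) =
        expectation (\<lambda>t. (indicat_real J t *\<^sub>R f t) \<bullet> a + indicat_real J t * \<beta>)"
    by (simp add: algebra_simps)
  also have "\<dots> = (LINT t:J|Q. f t) \<bullet> a + prob J * \<beta>"
  proof (subst Bochner_Integration.integral_add)
    show "integrable Q (\<lambda>t. (indicat_real J t *\<^sub>R f t) \<bullet> a)"
      by (intro integrable_inner_left i)
    show "integrable Q (\<lambda>t. indicat_real J t * \<beta>)" using J(1) by (simp add: emeasure_eq_measure)
    show "expectation (\<lambda>t. (indicat_real J t *\<^sub>R f t) \<bullet> a) + expectation (\<lambda>t. indicat_real J t * \<beta>)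
      = (LINT t:J|Q. f t) \<bullet> a + prob J * \<beta>"
      using i J(1) sets.sets_into_space[OF J(1)]
      by (subst integral_inner_left) (auto simp: set_lebesgue_integral_def Int_absorb2)
  qed
  also have "\<dots> = prob J * (mean \<bullet> a + \<beta>)"
    using J(2) by (simp add: mean_def distrib_left)
  finally show ?thesis .
qed

lemma expectation_on_J_eq_0:
  assumes nonneg: "\<And>t. t \<in> G \<inter> J \<Longrightarrow> 0 \<le> f t \<bullet> a + \<beta>" and "mean \<bullet> a + \<beta> = 0"
  shows "AE t in Q. t \<in> J \<longrightarrow> f t \<bullet> a + \<beta> = 0"
proof -
  let ?g = "\<lambda>t. indicat_real J t * (f t \<bullet> a + \<beta>)"
  have "AE t in Q. 0 \<le> ?g t"
    using AE_G by eventually_elim (use nonneg in \<open>auto simp: indicator_def\<close>)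
  moreover have "expectation ?g = 0" using assms(2) by (simp add: expectation_on_J)
  ultimately have "AE t in Q. ?g t = 0"
    using integral_nonneg_eq_0_iff_AE[OF integrable_affine(2)] by blast
  then show ?thesis by eventually_elim auto
qed

text \<open>If \<open>f\<close> were nowhere on one side of its mean, it would live on the vertical line through the
  mean, where the frontier lies strictly below.\<close>

lemma ex_side_of_mean:
  assumes "mean \<in> \<Omega>\<^sub>0" and "c \<noteq> 0"
  shows "\<exists>t\<in>G \<inter> J. c * (f t \<bullet> v) < c * (mean \<bullet> v)"
proof (rule ccontr)
  assume "\<not> ?thesis"
  then have "AE t in Q. t \<in> J \<longrightarrow> f t \<bullet> (c *\<^sub>R v) + - (mean \<bullet> (c *\<^sub>R v)) = 0"
    by (intro expectation_on_J_eq_0) (auto simp: not_less)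
  then have "AE t in Q. t \<in> J \<longrightarrow> f t \<bullet> (-d) + mean \<bullet> d > 0"
    using AE_G
  proof eventually_elim
    case (elim t)
    then show ?case
      using frontier_below[OF f_frontier assms(1), of t] assms(2) by auto
  qed
  \<comment> \<open>This positive function also averages to zero over \<open>J\<close>, so it
    vanishes almost everywhere there; hence \<open>J\<close> would be null.\<close>
  moreover have "AE t in Q. t \<in> J \<longrightarrow> f t \<bullet> (-d) + mean \<bullet> d = 0"
  proof -
    let ?g = "\<lambda>t. indicat_real J t * (f t \<bullet> (-d) + mean \<bullet> d)"
    have "AE t in Q. 0 \<le> ?g t"
      using calculation by eventually_elim (auto simp: indicator_def)
    moreover have "expectation ?g = 0" by (simp only: expectation_on_J) simp
    ultimately have "AE t in Q. ?g t = 0"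
      using integral_nonneg_eq_0_iff_AE[OF integrable_affine(2)] by blast
    then show ?thesis by eventually_elim auto
  qed
  ultimately have "AE t in Q. t \<notin> J" by eventually_elim auto
  then have "emeasure Q J = 0"
    using J(1) by (simp add: AE_iff_measurable[OF J(1)] sets.sets_into_space Collect_conj_eq Int_absorb1)
  then show False using J(2) by (simp add: measure_def)
qed

text \<open>For the case that \<open>J\<close> reaches the right end. Measured from a value
  \<open>?k\<close> attained on \<open>J\<close> left of the mean, the part off \<open>J\<close>
  contributes nothing positive, and the part on \<open>J\<close> is scaled by
  \<open>prob J < 1\<close>.\<close>

lemma expectation_less_mean:
  assumes "mean \<in> \<Omega>\<^sub>0" "prob J < 1" and left: "\<And>t s. t \<in> G - J \<Longrightarrow> s \<in> G \<inter> J \<Longrightarrow> f t \<bullet> v \<le> f s \<bullet> v"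
  shows "expectation f \<bullet> v < mean \<bullet> v"
proof -
  obtain s where s: "s \<in> G \<inter> J" "f s \<bullet> v < mean \<bullet> v"
    using ex_side_of_mean[OF assms(1), of 1] by auto
  let ?k = "f s \<bullet> v"
  have "expectation (\<lambda>t. f t \<bullet> v + - ?k) \<le> expectation (\<lambda>t. indicat_real J t * (f t \<bullet> v + - ?k))"
  proof (rule integral_mono_AE[OF integrable_affine(1,2)])
    show "AE t in Q. f t \<bullet> v + - ?k \<le> indicat_real J t * (f t \<bullet> v + - ?k)"
      using AE_G by eventually_elim (use left[OF _ s(1)] in \<open>auto simp: indicator_def\<close>)
  qed
  then have "expectation f \<bullet> v - ?k \<le> prob J * (mean \<bullet> v - ?k)"
    unfolding integrable_affine(3) expectation_on_J by simp
  also have "\<dots> < 1 * (mean \<bullet> v - ?k)"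
    using s(2) assms(2) by (intro mult_strict_right_mono) auto
  finally show ?thesis by simp
qed

text \<open>Monotonicity enters only through \<open>B\<close> and \<open>order\<close>: off
  \<open>J\<close>, \<open>f\<close> is either beyond \<open>B\<close> or left of all its values on
  \<open>J\<close>. The martingale enters only through \<open>jensen\<close>.\<close>

lemma mean_not_in:
  assumes \<Omega>\<^sub>1: "open \<Omega>\<^sub>1" "\<Omega>\<^sub>1 \<subseteq> \<Omega>\<^sub>0" "\<And>x t. x \<in> \<Omega>\<^sub>1 \<Longrightarrow> 0 \<le> t \<Longrightarrow> x + t *\<^sub>R d \<in> \<Omega>\<^sub>1"
    and disj: "\<Omega> \<inter> \<Omega>\<^sub>1 = {}"
    and jensen: "\<And>\<gamma> a \<beta>. (\<And>x. x \<in> \<Omega> \<Longrightarrow> x \<bullet> v = \<gamma> \<Longrightarrow> x \<bullet> a + \<beta> < 0) \<Longrightarrow>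
      wedge v \<gamma> a \<beta> (expectation f) \<le> expectation (\<lambda>t. wedge v \<gamma> a \<beta> (f t))"
    and B: "B \<in> frontier \<Omega>\<^sub>0" "\<And>s. s \<in> G \<inter> J \<Longrightarrow> f s \<bullet> v \<le> B \<bullet> v"
    and order: "\<And>t. t \<in> G - J \<Longrightarrow> B \<bullet> v \<le> f t \<bullet> v \<or> (\<forall>s\<in>G \<inter> J. f t \<bullet> v \<le> f s \<bullet> v)"
    and side: "mean \<bullet> v \<le> expectation f \<bullet> v"
  shows "mean \<notin> \<Omega>\<^sub>1"
proof
  assume mean: "mean \<in> \<Omega>\<^sub>1"
  then have mean0: "mean \<in> \<Omega>\<^sub>0" using \<Omega>\<^sub>1 by auto
  obtain e where e: "0 < e" "cball mean e \<subseteq> \<Omega>\<^sub>1"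
    using \<Omega>\<^sub>1(1) mean open_contains_cball by blast
  \<comment> \<open>The unit vector \<open>d\<close> keeps \<open>p\<close> in the ball, and the
    affine function below takes the value \<open>e\<close> at the mean.\<close>
  define p where "p = mean - e *\<^sub>R d"
  have "norm d = 1" using unit by (simp add: norm_eq_sqrt_inner)
  then have p: "p \<in> \<Omega>\<^sub>1" using e by (intro subsetD[OF e(2)]) (auto simp: p_def dist_norm)
  then have p0: "p \<in> \<Omega>\<^sub>0" using \<Omega>\<^sub>1 by auto
  have pv: "p \<bullet> v = mean \<bullet> v" using orth by (simp add: p_def inner_diff_left)
  obtain s where s: "s \<in> G \<inter> J" "f s \<bullet> v < mean \<bullet> v"
    using ex_side_of_mean[OF mean0, of 1] by auto
  \<comment> \<open>Somewhere on \<open>J\<close>, \<open>f\<close> is right of the mean, and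
    \<open>B\<close> is at least as far right.\<close>
  have pB: "p \<bullet> v < B \<bullet> v"
    using ex_side_of_mean[OF mean0, of "-1"] B(2) pv by force
  \<comment> \<open>The zero line passes through \<open>p\<close> and \<open>B\<close>; with
    \<open>d \<bullet> a = 1\<close> the affine function is the vertical height above it.\<close>
  define a where "a = d - (((B - p) \<bullet> d) / ((B - p) \<bullet> v)) *\<^sub>R v"
  define \<beta> where "\<beta> = - (p \<bullet> a)"
  have da: "d \<bullet> a = 1" using orth unit by (simp add: a_def inner_diff_right)
  have pa: "p \<bullet> a + \<beta> = 0" by (simp add: \<beta>_def)
  have "(B - p) \<bullet> a = 0" using pB by (simp add: a_def inner_diff_right inner_diff_left)
  then have Ba: "B \<bullet> a + \<beta> = 0" by (simp add: \<beta>_def inner_diff_left)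
  have ma: "mean \<bullet> a + \<beta> = e" using da by (simp add: \<beta>_def p_def inner_simps)
  let ?W = "wedge v (p \<bullet> v) a \<beta>"
  \<comment> \<open>A point of \<open>\<Omega>\<close> at or above \<open>p\<close> on this vertical
    line would lie in \<open>\<Omega>\<^sub>1\<close>.\<close>
  have "x \<bullet> a + \<beta> < 0" if x: "x \<in> \<Omega>" "x \<bullet> v = p \<bullet> v" for x
  proof (rule ccontr)
    have "x \<bullet> a + \<beta> = (x - p) \<bullet> d"
      using pa by (subst same_fibre[OF x(2)]) (simp add: inner_add_left da)
    moreover assume "\<not> x \<bullet> a + \<beta> < 0"
    ultimately have "p + ((x - p) \<bullet> d) *\<^sub>R d \<in> \<Omega>\<^sub>1"
      using p by (intro \<Omega>\<^sub>1(3)) auto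
    then show False using same_fibre[OF x(2)] disj x(1) by auto
  qed
  then have "?W (expectation f) \<le> expectation (\<lambda>t. ?W (f t))"
    by (rule jensen)
  also have "\<dots> \<le> expectation (\<lambda>t. (f t \<bullet> a + \<beta>) - indicat_real J t * (f t \<bullet> a + \<beta>))"
  proof (rule integral_mono_AE)
    have W: "?W (f t) \<le> (f t \<bullet> a + \<beta>) - indicat_real J t * (f t \<bullet> a + \<beta>)" if t: "t \<in> G" for t
    proof -
      consider "t \<in> J" | "t \<notin> J" "B \<bullet> v \<le> f t \<bullet> v"
        | "t \<notin> J" "\<forall>s\<in>G \<inter> J. f t \<bullet> v \<le> f s \<bullet> v"
        using order t by blast
      then show ?thesis
      proof cases
        case 1
        \<comment> \<open>Right of the cut, \<open>f t\<close> lies under the chord from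
          \<open>p\<close> to \<open>B\<close>; left of it the wedge is zero by definition.\<close>
        then have "f t \<bullet> a + \<beta> \<le> 0" if "p \<bullet> v \<le> f t \<bullet> v"
          using frontier_below_chord[OF f_frontier[OF t], of p B a \<beta>] that t B p0 da pa Ba
            closure_subset[of \<Omega>\<^sub>0] by (auto simp: frontier_def)
        then show ?thesis using 1 by (auto simp: wedge_def)
      next
        case 2
        then have "0 \<le> f t \<bullet> a + \<beta>"
          by (intro frontier_above_line[OF p0 B(1) pB da pa Ba f_frontier[OF t]])
        then show ?thesis using 2 by (simp add: wedge_def)
      next
        case 3
        \<comment> \<open>A negative value at \<open>f t\<close> would put all of \<open>f\<close>
          on \<open>J\<close> under the chord from \<open>f t\<close> to \<open>B\<close>, where the
          affine function is nonpositive, although its average over \<open>J\<close> is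
          \<open>e\<close>.\<close>
        have "0 \<le> f t \<bullet> a + \<beta>"
        proof (rule ccontr)
          assume neg: "\<not> ?thesis"
          have below: "f r \<bullet> a + \<beta> \<le> 0" if "r \<in> G \<inter> J" for r
            using frontier_below_chord[OF f_frontier, of r "f t" B a \<beta>] f_frontier[OF t] that 3 B neg da Ba
            by (auto simp: frontier_def)
          have "AE r in Q. indicat_real J r * (f r \<bullet> a + \<beta>) \<le> 0"
            using AE_G by eventually_elim (use below in \<open>auto simp: indicator_def\<close>)
          then have "expectation (\<lambda>r. indicat_real J r * (f r \<bullet> a + \<beta>)) \<le> 0"
            using integral_mono_AE[OF integrable_affine(2), of "\<lambda>_. 0"] by simp
          then show False
            unfolding expectation_on_J ma using J(2) e(1) by (simp add: mult_le_0_iff)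
        qed
        \<comment> \<open>The point \<open>s\<close> of \<open>J\<close> has its value strictly left
          of the mean, and \<open>f t\<close> is no further right.\<close>
        moreover have "f t \<bullet> v < p \<bullet> v" using 3(2) s pv by force
        ultimately show ?thesis using 3(1) by (simp add: wedge_def)
      qed
    qed
    show "AE t in Q. ?W (f t) \<le> (f t \<bullet> a + \<beta>) - indicat_real J t * (f t \<bullet> a + \<beta>)"
      using AE_G by eventually_elim (rule W)
  qed (intro integrable_wedge integrable_f Bochner_Integration.integrable_diff integrable_affine)+
  also have "\<dots> = expectation f \<bullet> a + \<beta> - prob J * e"
    by (subst Bochner_Integration.integral_diff[OF integrable_affine(1,2)])
       (simp only: integrable_affine(3) expectation_on_J ma)
  also have "\<dots> < expectation f \<bullet> a + \<beta>" using J(2) e(1) by simp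
  also have "\<dots> \<le> ?W (expectation f)" using side pv by (simp add: wedge_def)
  finally show False by simp
qed

end

section \<open>Rearrangements\<close>

lemma convex_ray_translate:
  fixes C :: "'a::real_normed_vector set"
  assumes C: "open C" "convex C" and ray: "\<And>t. 0 \<le> t \<Longrightarrow> q + t *\<^sub>R d \<in> C"
    and x: "x \<in> C" and t: "0 \<le> t"
  shows "x + t *\<^sub>R d \<in> C"
proof -
  \<comment> \<open>By openness a point slightly beyond \<open>x\<close>, seen from
    \<open>q\<close>, is still in \<open>C\<close>; the target is a convex combination of it and a
    far point of the ray from \<open>q\<close>.\<close>
  have "((\<lambda>e. x + e *\<^sub>R (x - q)) \<longlongrightarrow> x + 0 *\<^sub>R (x - q)) (at_right (0::real))"
    by (intro tendsto_intros)
  then have "eventually (\<lambda>e. x + e *\<^sub>R (x - q) \<in> C) (at_right (0::real))"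
    using C(1) x by (intro topological_tendstoD) auto
  then obtain e :: real where e: "0 < e" "x + e *\<^sub>R (x - q) \<in> C"
    using eventually_happens'[OF _ eventually_conj[OF _ eventually_at_right_less[of 0]]]
    by (metis trivial_limit_at_right_real)
  have "(1 / (1 + e)) *\<^sub>R (x + e *\<^sub>R (x - q)) + (e / (1 + e)) *\<^sub>R (q + (t * (1 + e) / e) *\<^sub>R d) \<in> C"
    using e t by (intro convexD[OF C(2)] ray) (auto simp: field_simps)
  also have "(1 / (1 + e)) *\<^sub>R (x + e *\<^sub>R (x - q)) + (e / (1 + e)) *\<^sub>R (q + (t * (1 + e) / e) *\<^sub>R d)
    = (1 / (1 + e)) *\<^sub>R ((1 + e) *\<^sub>R x) + (e / (1 + e) * (t * (1 + e) / e)) *\<^sub>R d"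
    by (simp add: algebra_simps)
  also have "\<dots> = x + t *\<^sub>R d" using e by simp
  finally show ?thesis .
qed

lemma ex_frontier_on_segment:
  fixes x d :: "'a::real_normed_vector"
  assumes "x \<in> C" "x + t *\<^sub>R d \<notin> C" "open C"
  obtains s where "0 < s" "x + (s * t) *\<^sub>R d \<in> frontier C"
proof -
  have "closed_segment x (x + t *\<^sub>R d) \<inter> frontier C \<noteq> {}"
    using assms(1,2) by (intro connected_Int_frontier) auto
  then obtain s where s: "0 \<le> s" "s \<le> 1" "(1 - s) *\<^sub>R x + s *\<^sub>R (x + t *\<^sub>R d) \<in> frontier C"
    by (auto simp: in_segment)
  then have f: "x + (s * t) *\<^sub>R d \<in> frontier C" by (simp add: algebra_simps)
  moreover have "s \<noteq> 0"
    using f assms(1,3) by (auto simp: frontier_def interior_open)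
  ultimately show ?thesis using s that[of s] by simp
qed

text \<open>Injectivity of the projection makes the lines orthogonal to \<open>u\<close> meet the frontier at most
  once, so one half of each of them stays in the domain.\<close>

lemma ex_ray_in_direction:
  fixes C :: "'a::euclidean_space set"
  assumes C: "open C" "x \<in> C" and no_line: "\<not> line x e \<subseteq> C"
    and inj: "inj_on (\<lambda>x. x \<bullet> u) (frontier C)" and orth: "e \<bullet> u = 0" "e \<noteq> 0"
  obtains \<sigma> :: real where "\<sigma> = 1 \<or> \<sigma> = -1" "ray x (\<sigma> *\<^sub>R e) \<subseteq> C"
proof (rule ccontr)
  assume "\<not> thesis"
  then have "\<not> ray x (1 *\<^sub>R e) \<subseteq> C" "\<not> ray x (-1 *\<^sub>R e) \<subseteq> C"
    using that[of 1] that[of "-1"] by auto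
  then obtain t t' where t: "0 \<le> t" "x + t *\<^sub>R e \<notin> C" and t': "0 \<le> t'" "x + (- t') *\<^sub>R e \<notin> C"
    by (auto simp: ray_def)
  then have pos: "0 < t" "0 < t'" using C(2) by (auto simp: less_le)
  obtain s where s: "0 < s" "x + (s * t) *\<^sub>R e \<in> frontier C"
    using ex_frontier_on_segment[OF C(2) t(2) C(1)] by blast
  obtain s' where s': "0 < s'" "x + (s' * (- t')) *\<^sub>R e \<in> frontier C"
    using ex_frontier_on_segment[OF C(2) t'(2) C(1)] by blast
  have "x + (s * t) *\<^sub>R e = x + (s' * (- t')) *\<^sub>R e"
    using orth s s' by (intro inj_onD[OF inj]) (auto simp: inner_simps)
  then have "s * t = s' * (- t')"
    using orth(2) by (metis add_left_cancel scaleR_right_imp_eq)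
  moreover have "0 < s * t" "0 < s' * t'" using s(1) s'(1) pos by auto
  ultimately show False by simp
qed

text \<open>Here dimension two enters: \<open>u\<close> turned by a right angle spans its orthogonal
  complement.\<close>

lemma plane_orthogonal:
  fixes u :: "real^2"
  assumes "norm u = 1"
  obtains e where "e \<bullet> u = 0" "e \<bullet> e = 1" "\<And>x. x \<bullet> u = 0 \<Longrightarrow> x = (x \<bullet> e) *\<^sub>R e"
proof
  let ?e = "vector [- (u $ 2), u $ 1] :: real^2"
  have u: "u $ 1 * u $ 1 + u $ 2 * u $ 2 = 1"
    using assms by (simp add: norm_eq_sqrt_inner inner_vec_def sum_2)
  show "?e \<bullet> u = 0" "?e \<bullet> ?e = 1"
    using u by (auto simp: inner_vec_def sum_2)
  show "x = (x \<bullet> ?e) *\<^sub>R ?e" if "x \<bullet> u = 0" for x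
  proof -
    have x: "x $ 1 * u $ 1 + x $ 2 * u $ 2 = 0"
      using that by (simp add: inner_vec_def sum_2)
    have "x $ 1 = (- (x $ 1) * u $ 2 + x $ 2 * u $ 1) * - (u $ 2)"
      and "x $ 2 = (- (x $ 1) * u $ 2 + x $ 2 * u $ 1) * u $ 1"
      using u x by algebra+
    then show ?thesis
      by (simp add: vec_eq_iff forall_2 inner_vec_def sum_2)
  qed
qed

section \<open>Averages over subintervals of the unit interval\<close>

lemma prob_space_unit_interval: "prob_space (lebesgue_on {0..1::real})"
  by (rule prob_spaceI) (simp add: emeasure_restrict_space)

lemma average_unit_interval:
  assumes "J \<in> sets lebesgue" "J \<subseteq> {0..1}"
  shows "average \<phi> J = (1 / measure (lebesgue_on {0..1}) J) *\<^sub>R (LINT t:J|lebesgue_on {0..1}. \<phi> t)"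
proof -
  have "(LINT t:J|lebesgue_on {0..1}. \<phi> t) = (LINT t:{0..1}|lebesgue. indicat_real J t *\<^sub>R \<phi> t)"
    unfolding set_lebesgue_integral_def by (subst integral_restrict_space) (auto simp: set_lebesgue_integral_def)
  also have "\<dots> = (LINT t:J|lebesgue. \<phi> t)"
    unfolding set_lebesgue_integral_def using assms(2)
    by (intro Bochner_Integration.integral_cong) (auto simp: indicator_def)
  finally show ?thesis
    using assms by (simp add: average_def measure_restrict_space)
qed

text \<open>The reflection \<open>c = -1\<close> exchanges the two sides of \<open>J\<close>.\<close>

lemma interval_mean_not_in:
  fixes \<phi> :: "real \<Rightarrow> 'a::euclidean_space" and c :: real
  assumes frontier_average: "frontier_average \<Omega>\<^sub>0 (c *\<^sub>R u) d (lebesgue_on {0..1}) \<phi> J {0<..<1}"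
    and c: "c = 1 \<or> c = -1" and mono: "mono_on {0<..<1} (\<lambda>t. \<phi> t \<bullet> u)"
    and ivl: "is_interval J" "J \<subseteq> {0..1}"
    and \<Omega>\<^sub>1: "open \<Omega>\<^sub>1" "\<Omega>\<^sub>1 \<subseteq> \<Omega>\<^sub>0" "\<And>x t. x \<in> \<Omega>\<^sub>1 \<Longrightarrow> 0 \<le> t \<Longrightarrow> x + t *\<^sub>R d \<in> \<Omega>\<^sub>1"
    and disj: "\<Omega> \<inter> \<Omega>\<^sub>1 = {}" and total: "(LINT t|lebesgue_on {0..1}. \<phi> t) \<in> \<Omega>"
    and jensen: "\<And>\<gamma> a \<beta>. (\<And>x. x \<in> \<Omega> \<Longrightarrow> x \<bullet> (c *\<^sub>R u) = \<gamma> \<Longrightarrow> x \<bullet> a + \<beta> < 0) \<Longrightarrow>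
      wedge (c *\<^sub>R u) \<gamma> a \<beta> (LINT t|lebesgue_on {0..1}. \<phi> t)
        \<le> (LINT t|lebesgue_on {0..1}. wedge (c *\<^sub>R u) \<gamma> a \<beta> (\<phi> t))"
    and side: "average \<phi> J \<bullet> (c *\<^sub>R u) \<le> (LINT t|lebesgue_on {0..1}. \<phi> t) \<bullet> (c *\<^sub>R u)"
  shows "average \<phi> J \<notin> \<Omega>\<^sub>1"
proof
  let ?Q = "lebesgue_on {0..1::real}" and ?G = "{0<..<1::real}"
  interpret frontier_average \<Omega>\<^sub>0 "c *\<^sub>R u" d ?Q \<phi> J ?G
    "(1 / measure ?Q J) *\<^sub>R (LINT t:J|?Q. \<phi> t)"
    by (fact frontier_average)
  have "bounded J" using ivl(2) by (rule bounded_subset[OF bounded_closed_interval])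
  then have "J \<in> sets lebesgue"
    using measurable_convex[OF is_interval_convex[OF ivl(1)]] fmeasurableD by blast
  then have avg: "average \<phi> J = (1 / measure ?Q J) *\<^sub>R (LINT t:J|?Q. \<phi> t)"
    using ivl(2) by (rule average_unit_interval)
  assume mean: "average \<phi> J \<in> \<Omega>\<^sub>1"
  \<comment> \<open>The parameter order, reversed for \<open>c = -1\<close>, makes
    \<open>\<phi>\<close> non-decreasing along \<open>c *\<^sub>R u\<close> in both cases.\<close>
  define le where "le t s \<longleftrightarrow> c * t \<le> c * s" for t s :: real
  have mono': "\<phi> t \<bullet> (c *\<^sub>R u) \<le> \<phi> s \<bullet> (c *\<^sub>R u)" if "t \<in> ?G" "s \<in> ?G" "le t s" for t s
    using c that mono_onD[OF mono, of t s] mono_onD[OF mono, of s t] by (auto simp: le_def)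
  have dich: "(\<forall>s\<in>J. le t s) \<or> (\<forall>s\<in>J. le s t)" if "t \<notin> J" for t
  proof -
    have "(\<forall>s\<in>J. t \<le> s) \<or> (\<forall>s\<in>J. s \<le> t)"
      using that ivl(1) unfolding is_interval_1 by (meson linear)
    then show ?thesis using c by (auto simp: le_def)
  qed
  have mean0: "average \<phi> J \<in> \<Omega>\<^sub>0" using mean \<Omega>\<^sub>1(2) by auto
  obtain s0 where s0: "s0 \<in> ?G \<inter> J"
    using ex_side_of_mean[of 1] mean0 unfolding avg by auto
  show False
  \<comment> \<open>Either the last end point \<open>b\<close> of \<open>J\<close> is in the open
    interval, and \<open>\<phi> b\<close> serves as \<open>B\<close>, or no point of the open
    interval comes after \<open>J\<close>.\<close>
  proof (cases "\<exists>r\<in>?G. \<forall>s\<in>J. le s r")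
    case True
    then obtain r where r: "r \<in> ?G" "\<forall>s\<in>J. le s r" by blast
    have "\<exists>b. (\<forall>s\<in>J. le s b) \<and> (\<forall>t. (\<forall>s\<in>J. le s t) \<longrightarrow> le b t)"
    proof (cases "c = 1")
      case True
      have "bdd_above J" "J \<noteq> {}" using ivl(2) s0 by (auto intro!: bdd_above_mono[OF _ ivl(2)])
      then show ?thesis
        using True by (intro exI[of _ "Sup J"]) (auto simp: le_def intro: cSup_upper cSup_least)
    next
      case False
      have "bdd_below J" "J \<noteq> {}" using ivl(2) s0 by (auto intro!: bdd_below_mono[OF _ ivl(2)])
      then show ?thesis
        using False c by (intro exI[of _ "Inf J"]) (auto simp: le_def intro: cInf_lower cInf_greatest)
    qed
    then obtain b where b: "\<And>s. s \<in> J \<Longrightarrow> le s b" "\<And>t. (\<forall>s\<in>J. le s t) \<Longrightarrow> le b t" by blast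
    have "le s0 b" "le b r" using b r s0 by auto
    then have bG: "b \<in> ?G" using s0 r(1) c by (auto simp: le_def)
    have "average \<phi> J \<notin> \<Omega>\<^sub>1"
      unfolding avg
    proof (rule mean_not_in[OF \<Omega>\<^sub>1 disj jensen])
      show "\<phi> b \<in> frontier \<Omega>\<^sub>0" using bG by (rule f_frontier)
      show "\<phi> s \<bullet> (c *\<^sub>R u) \<le> \<phi> b \<bullet> (c *\<^sub>R u)" if "s \<in> ?G \<inter> J" for s
        using that by (intro mono' bG b(1)) auto
      show "\<phi> b \<bullet> (c *\<^sub>R u) \<le> \<phi> t \<bullet> (c *\<^sub>R u) \<or> (\<forall>s\<in>?G \<inter> J. \<phi> t \<bullet> (c *\<^sub>R u) \<le> \<phi> s \<bullet> (c *\<^sub>R u))"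
        if t: "t \<in> ?G - J" for t
        using dich[of t]
      proof
        assume "\<forall>s\<in>J. le s t"
        then show ?thesis using mono'[OF bG _ b(2)] t by auto
      next
        assume "\<forall>s\<in>J. le t s"
        then show ?thesis using mono' t by auto
      qed (use t in auto)
    qed (use side avg in auto)
    then show False using mean by simp
  next
    case False
    show False
    \<comment> \<open>Now the rest of the interval precedes \<open>J\<close>: the total mean lies
      strictly left of the average, against \<open>side\<close>, unless \<open>J\<close> has full
      measure. Then both means agree, and the total one is in \<open>\<Omega>\<close>.\<close>
    proof (cases "prob J < 1")
      case True
      have "\<phi> t \<bullet> (c *\<^sub>R u) \<le> \<phi> s \<bullet> (c *\<^sub>R u)" if "t \<in> ?G - J" "s \<in> ?G \<inter> J" for t s
        using dich[of t] False that mono'[of t s] by auto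
      then show False
        using expectation_less_mean[OF _ True] mean0 side unfolding avg by force
    next
      case False
      then have J1: "prob J = 1" using prob_le_1[of J] by linarith
      then have "AE t in ?Q. t \<in> J" using prob_eq_1[OF J(1)] by simp
      then have "(LINT t:J|?Q. \<phi> t) = expectation \<phi>"
        unfolding set_lebesgue_integral_def using J(1) integrable_f
        by (intro integral_cong_AE) (auto simp: borel_measurable_integrable)
      then have "average \<phi> J = expectation \<phi>" using J1 avg by simp
      then show False using mean total disj by auto
    qed
  qed
qed

theorem theorem3p4:
  fixes \<Omega>\<^sub>0 \<Omega>\<^sub>1 \<Omega> :: "(real^2) set" and u :: "real^2"
    and P :: "'s measure" and S :: "nat \<Rightarrow> 's set set"
    and M :: "nat \<Rightarrow> 's \<Rightarrow> real^2" and Minf :: "'s \<Rightarrow> real^2"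
    and \<phi> :: "real \<Rightarrow> real^2"
  assumes "\<Omega>\<^sub>0 \<noteq> {}" and "open \<Omega>\<^sub>0" and "convex \<Omega>\<^sub>0"
    and no_lines: "\<And>p v. v \<noteq> 0 \<Longrightarrow> \<not> line p v \<subseteq> \<Omega>\<^sub>0"
    and "open \<Omega>\<^sub>1" and "convex \<Omega>\<^sub>1" and "closure \<Omega>\<^sub>1 \<subseteq> \<Omega>\<^sub>0"
    and "\<Omega> = closure (\<Omega>\<^sub>0 - \<Omega>\<^sub>1)"
    and no_segments0: "\<And>a b. a \<noteq> b \<Longrightarrow> \<not> closed_segment a b \<subseteq> frontier \<Omega>\<^sub>0"
    and no_segments1: "\<And>a b. a \<noteq> b \<Longrightarrow> \<not> closed_segment a b \<subseteq> frontier \<Omega>\<^sub>1"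
    and "\<not> bounded \<Omega>\<^sub>0"
    and rays: "\<And>p v. v \<noteq> 0 \<Longrightarrow> ray p v \<subseteq> \<Omega>\<^sub>0 \<Longrightarrow> \<exists>c. (\<lambda>x. c + x) ` ray p v \<subseteq> \<Omega>\<^sub>1"
    and "norm u = 1" and "inj_on (\<lambda>x. x \<bullet> u) (frontier \<Omega>\<^sub>0)"
    and "standard_prob_space P"
    and "w_martingale P S \<Omega> M Minf"
    and "nondecreasing_rearrangement u \<Omega>\<^sub>0 (distr P borel Minf) \<phi>"
  shows "\<phi> \<in> A_class \<Omega>\<^sub>0 \<Omega>\<^sub>1 {0..1}"
proof -
  let ?Q = "lebesgue_on {0..1::real}"
  obtain x0 where x0: "x0 \<in> \<Omega>\<^sub>0" using assms(1) by auto
  obtain e where e: "e \<bullet> u = 0" "e \<bullet> e = 1" "\<And>x. x \<bullet> u = 0 \<Longrightarrow> x = (x \<bullet> e) *\<^sub>R e"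
    using plane_orthogonal[OF \<open>norm u = 1\<close>] by blast
  then have "e \<noteq> 0" by auto
  obtain \<sigma> :: real where \<sigma>: "\<sigma> = 1 \<or> \<sigma> = -1" "ray x0 (\<sigma> *\<^sub>R e) \<subseteq> \<Omega>\<^sub>0"
    using ex_ray_in_direction[OF assms(2) x0 no_lines[OF \<open>e \<noteq> 0\<close>] assms(14) e(1) \<open>e \<noteq> 0\<close>] by blast
  define d where "d = \<sigma> *\<^sub>R e"
  have d: "d \<bullet> u = 0" "d \<bullet> d = 1" "\<And>x. x \<bullet> u = 0 \<Longrightarrow> x = (x \<bullet> d) *\<^sub>R d"
    using e \<sigma>(1) by (auto simp: d_def)
  then have "d \<noteq> 0" by auto
  \<comment> \<open>One ray in \<open>\<Omega>\<^sub>0\<close> makes \<open>d\<close> a recession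
    direction of the whole set; its translate does the same for
    \<open>\<Omega>\<^sub>1\<close>.\<close>
  have up0: "x + t *\<^sub>R d \<in> \<Omega>\<^sub>0" if "x \<in> \<Omega>\<^sub>0" "0 \<le> t" for x t
    using convex_ray_translate[OF assms(2,3) _ that, of x0 d] \<sigma>(2) by (auto simp: ray_def d_def)
  obtain c where "(\<lambda>x. c + x) ` ray x0 d \<subseteq> \<Omega>\<^sub>1"
    using rays[OF \<open>d \<noteq> 0\<close>] \<sigma>(2) d_def by blast
  then have "(c + x0) + t *\<^sub>R d \<in> \<Omega>\<^sub>1" if "0 \<le> t" for t
    using that by (auto simp: ray_def image_subset_iff add.assoc)
  then have up1: "x + t *\<^sub>R d \<in> \<Omega>\<^sub>1" if "x \<in> \<Omega>\<^sub>1" "0 \<le> t" for x t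
    using convex_ray_translate[OF assms(5,6) _ that, of "c + x0" d] by blast
  have disj: "\<Omega> \<inter> \<Omega>\<^sub>1 = {}"
    using open_Int_closure_eq_empty[OF assms(5), of "\<Omega>\<^sub>0 - \<Omega>\<^sub>1"] assms(8) by auto
  have sub: "\<Omega>\<^sub>1 \<subseteq> \<Omega>\<^sub>0" using assms(7) closure_subset by blast

  interpret prob_space P using assms(15) by (simp add: standard_prob_space_def)
  interpret w_martingale_on P S \<Omega> M Minf
    by unfold_locales (use assms in auto)
  interpret Q: prob_space ?Q by (rule prob_space_unit_interval)
  have \<phi>: "\<phi> ` {0..1} \<subseteq> frontier \<Omega>\<^sub>0" "mono_on {0<..<1} (\<lambda>t. \<phi> t \<bullet> u)"
    and [measurable]: "\<phi> \<in> borel_measurable ?Q"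
    and distr: "distr ?Q borel \<phi> = distr P borel Minf"
    using assms(17) by (auto simp: nondecreasing_rearrangement_def)
  have "integrable (distr P borel Minf) (\<lambda>x. x)"
    using integrable_Minf by (subst integrable_distr_eq) auto
  then have int: "integrable ?Q \<phi>"
    unfolding distr[symmetric] by (subst (asm) integrable_distr_eq) auto
  \<comment> \<open>Equality of laws carries the Jensen inequality from \<open>Minf\<close> over to
    \<open>\<phi>\<close>.\<close>
  have transfer: "(LINT t|?Q. g (\<phi> t)) = expectation (\<lambda>x. g (Minf x))"
    if [measurable]: "g \<in> borel_measurable borel" for g :: "real^2 \<Rightarrow> 'b::{banach, second_countable_topology}"
    using integral_distr[of \<phi> ?Q borel g] integral_distr[of Minf P borel g] by (simp add: distr)
  have total: "(LINT t|?Q. \<phi> t) = expectation Minf"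
    using transfer[of "\<lambda>x. x"] by simp

  have "average \<phi> J \<notin> \<Omega>\<^sub>1" if J: "is_interval J" "J \<subseteq> {0..1}" "0 < measure lebesgue J" for J
  proof -
    \<comment> \<open>The sign puts the total mean on the right of the average, or level with it,
      along \<open>c *\<^sub>R u\<close>.\<close>
    define c :: real where "c = (if average \<phi> J \<bullet> u \<le> (LINT t|?Q. \<phi> t) \<bullet> u then 1 else -1)"
    have c: "c = 1 \<or> c = -1" by (simp add: c_def)
    have "bounded J" using J(2) by (rule bounded_subset[OF bounded_closed_interval])
    then have "J \<in> sets lebesgue"
      using measurable_convex[OF is_interval_convex[OF J(1)]] fmeasurableD by blast
    then have JQ: "J \<in> sets ?Q" "0 < measure ?Q J"
      using J by (auto simp: sets_restrict_space_iff measure_restrict_space)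
    have "frontier_average \<Omega>\<^sub>0 (c *\<^sub>R u) d ?Q \<phi> J {0<..<1}"
    proof unfold_locales
      show "inj_on (\<lambda>x. x \<bullet> (c *\<^sub>R u)) (frontier \<Omega>\<^sub>0)"
        using assms(14) c by (auto simp: inj_on_def)
      show "\<phi> t \<in> frontier \<Omega>\<^sub>0" if "t \<in> {0<..<1}" for t
        using \<phi>(1) that by (auto simp: image_subset_iff)
      show "AE t in ?Q. t \<in> {0<..<1}"
      proof -
        have "{0, 1::real} \<in> null_sets lebesgue"
          by (intro finite_imp_null_set_lborel[THEN null_sets_completionI]) auto
        then have "AE t in lebesgue. t \<notin> {0, 1::real}" by (rule AE_not_in)
        then have "AE t in lebesgue. t \<in> {0..1} \<longrightarrow> t \<in> {0<..<1::real}"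
          by eventually_elim auto
        then show ?thesis by (subst AE_restrict_space_iff) auto
      qed
    qed (use assms c d up0 int JQ \<phi>(1) in auto)
    then show ?thesis
    proof (rule interval_mean_not_in[OF _ c \<phi>(2) J(1,2) assms(5) sub up1 disj])
      show "average \<phi> J \<bullet> (c *\<^sub>R u) \<le> (LINT t|?Q. \<phi> t) \<bullet> (c *\<^sub>R u)"
        by (auto simp: c_def)
      show "(LINT t|?Q. \<phi> t) \<in> \<Omega>" unfolding total by (rule expectation_Minf_in)
      fix \<gamma> a \<beta> assume "\<And>x. x \<in> \<Omega> \<Longrightarrow> x \<bullet> (c *\<^sub>R u) = \<gamma> \<Longrightarrow> x \<bullet> a + \<beta> < 0"
      then show "wedge (c *\<^sub>R u) \<gamma> a \<beta> (LINT t|?Q. \<phi> t) \<le> (LINT t|?Q. wedge (c *\<^sub>R u) \<gamma> a \<beta> (\<phi> t))"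
        unfolding total transfer[OF borel_measurable_wedge] by (rule wedge_expectation_le)
    qed
  qed
  moreover have "\<phi> absolutely_integrable_on {0..1}"
    using int by (simp add: integrable_restrict_space set_integrable_def)
  ultimately show ?thesis
    using \<phi>(1) by (simp add: A_class_def)
qed

end
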